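(* Let $\mathcal{L}$ be a finite-valued propositional logic and $\mathcal{I}\subseteq\mathcal{V}_\mathcal{L}$ a set of truth values, with $\mathcal{L}$ containing the unary connectives $\mathbf{I}$ and $\overline{\mathbf{I}}$ described in the context. If an $\mathsf{ME}^{\mathcal{I}}_{\mathcal{L}}$-sequent $\Sigma ; \Gamma \Rightarrow^{\mathcal{I}}_{\mathcal{L}} \Delta ; \Theta$, with $\Sigma,\Theta$ finite sets of propositional constants and $\Gamma,\Delta$ finite sets of formulas, is true, then it is provable in the calculus $\mathsf{ME}^\mathcal{I}_\mathcal{L}$.
   Context: A finite-valued propositional logic $\mathcal{L}$ has truth values $\mathcal{V}_\mathcal{L}=\{t_1,\dots,t_n\}$ containing $\mathbf{t},\mathbf{f}$, designated values $\mathcal{V}^+_\mathcal{L}\subset\mathcal{V}_\mathcal{L}$ with $\mathbf{t}\in\mathcal{V}^+_\mathcal{L}$, $\mathbf{f}\notin\mathcal{V}^+_\mathcal{L}$, a fixed countably infinite set $\mathcal{C}$ of propositional constants, and finitely many connectives interpreted by truth functions on $\mathcal{V}_\mathcal{L}$. Interpretations are maps $I:\mathcal{C}\to\mathcal{V}_\mathcal{L}$, extended compositionally to valuations $v^I_\mathcal{L}$; $I$ is a model of $\varphi$ if $v^I_\mathcal{L}(\varphi)\in\mathcal{V}^+_\mathcal{L}$, and of a theory (set of formulas) if it models all its elements. It is assumed that $\mathcal{L}$ contains unary connectives $\mathbf{I}$ and $\overline{\mathbf{I}}$ with $v(\mathbf{I}\varphi)=\mathbf{t}$ if $v(\varphi)\in\mathcal{I}$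 and $=\mathbf{f}$ otherwise, and $v(\overline{\mathbf{I}}\varphi)=\mathbf{t}$ if $v(\varphi)\notin\mathcal{I}$ and $=\mathbf{f}$ otherwise. For $\Theta\subseteq\mathcal{C}$ write $\mathbf{I}\Theta=\{\mathbf{I}p\mid p\in\Theta\}$, $\overline{\mathbf{I}}\Theta=\{\overline{\mathbf{I}}p\mid p\in\Theta\}$. An $\mathcal{L}$-sequent is an $n$-tuple $\Gamma_1\mid\dots\mid\Gamma_n$ of finite sets of formulas, component $i$ associated with $t_i$; it is true under $I$ if some $\Gamma_i$ contains $\varphi$ with $v^I_\mathcal{L}(\varphi)=t_i$, and valid if true under every $I$. An $\mathcal{L}$-anti-sequent $\Gamma_1\nmid\dots\nmid\Gamma_n$ (finite sets) is refuted by $I$ if no $\Gamma_i$ contains $\varphi$ with $v^I_\mathcal{L}(\varphi)=t_i$, and refutable if refuted by some $I$. With $M^+=\{i\mid t_i\in\mathcal{V}^+_\mathcal{L}\}$ and $M^-=\{i\mid t_i\notin\mathcal{V}^+_\mathcal{L}\}$, $\Gamma\vdash_\mathcal{L}\Delta$ denotes the $\mathcal{L}$-sequent whose $i$-th component is $\Gamma$ for $i\in M^-$ and $\Delta$ for $i\in M^+$, and $\Gamma\dashv_\mathcal{L}\Delta$ the analogous anti-sequent. $\mathsf{S}_\mathcal{L}$ and $\mathsf{R}_\mathcal{L}$ are the sequent and anti-sequent calculi for $\mathcal{L}$ (over a vocabulary including $\mathbf{I},\overline{\mathbf{I}}$) obtained by the constructions of Zach and of Bogojeski–Tompits; they satisfy: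 an $\mathcal{L}$-sequent is provable in $\mathsf{S}_\mathcal{L}$ iff it is valid, and an $\mathcal{L}$-anti-sequent is provable in $\mathsf{R}_\mathcal{L}$ iff it is refutable. For $\Theta\subseteq\mathcal{C}$ and interpretations $I,J$: $I\le^{\mathcal{I},\Theta}_\mathcal{L}J$ iff $\{p\in\Theta\mid v^I_\mathcal{L}(p)\in\mathcal{I}\}\subseteq\{p\in\Theta\mid v^J_\mathcal{L}(p)\in\mathcal{I}\}$; $<$ is its strict part. A model $I$ of $\Gamma$ is $(\mathcal{I};\Theta)$-minimal if no model $J$ of $\Gamma$ has $J<^{\mathcal{I},\Theta}_\mathcal{L}I$. An $\mathsf{ME}^{\mathcal{I}}_{\mathcal{L}}$-sequent is a quadruple $\Sigma;\Gamma\Rightarrow^{\mathcal{I}}_{\mathcal{L}}\Delta;\Theta$ with $\Sigma,\Theta\subseteq\mathcal{C}$ and $\Gamma,\Delta$ theories; it is true if every $(\mathcal{I};\Theta\cup\Sigma)$-minimal model $I$ of $\Gamma$ with $v^I_\mathcal{L}(p)\in\mathcal{I}$ for all $p\in\Sigma$ is a model of some $\varphi\in\Delta$. The calculus $\mathsf{ME}^{\mathcal{I}}_{\mathcal{L}}$ consists of $\mathsf{S}_\mathcal{L}$, $\mathsf{R}_\mathcal{L}$, and three rules for $\mathsf{ME}$-sequents: $(m_1)$: from the anti-sequent $\Gamma,\overline{\mathbf{I}}\Theta\dashv_\mathcal{L}\mathbf{I}q$ (provable in $\mathsf{R}_\mathcal{L}$) infer $\{q\}\cup\Sigma;\Gamma\Rightarrow^{\mathcal{I}}_{\mathcal{L}}\Delta;\Theta$;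 $(m_2)$: from the sequent $\mathbf{I}\Sigma,\Gamma\vdash_\mathcal{L}\Delta$ (provable in $\mathsf{S}_\mathcal{L}$) infer $\Sigma;\Gamma\Rightarrow^{\mathcal{I}}_{\mathcal{L}}\Delta;\Theta$; $(m_3)$: from $\{q\}\cup\Sigma;\Gamma\Rightarrow^{\mathcal{I}}_{\mathcal{L}}\Delta;\Theta$ and $\Sigma;\Gamma\cup\{\overline{\mathbf{I}}q\}\Rightarrow^{\mathcal{I}}_{\mathcal{L}}\Delta;\Theta$ infer $\Sigma;\Gamma\Rightarrow^{\mathcal{I}}_{\mathcal{L}}\Delta;\Theta\cup\{q\}$. Here $q\in\mathcal{C}$, $\Sigma,\Theta\subseteq\mathcal{C}$. *)

theory Defs
  imports Main "HOL-Library.Countable" "HOL-Library.Infinite_Typeclass"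
begin

section \<open>Finite-valued propositional logics\<close>

text \<open>
  The truth values are the elements of a finite type \<open>'v\<close>, the connectives those of a
  finite type \<open>'c\<close> (nullary connectives are allowed), and the propositional constants those of a
  countably infinite type \<open>'p\<close>.
\<close>

record ('v, 'c) logic =
  tt :: 'v
  ff :: 'v
  designated :: "'v set"
  arity :: "'c \<Rightarrow> nat"
  tfun :: "'c \<Rightarrow> 'v list \<Rightarrow> 'v"

definition finite_valued_logic :: "('v::finite, 'c::finite) logic \<Rightarrow> bool" where
  "finite_valued_logic L \<longleftrightarrow> tt L \<in> designated L \<and> ff L \<notin> designated L"

datatype ('p, 'c) fm = Atom 'p | Conn 'c "('p, 'c) fm list"

text \<open>
  The type \<open>fm\<close> does not enforce arities; the formulas of \<open>L\<close> are the elements of \<open>formulas L\<close>.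
  Only the values of \<open>tfun L c\<close> on lists of length \<open>arity L c\<close> matter.
\<close>

inductive_set formulas :: "('v, 'c) logic \<Rightarrow> ('p, 'c) fm set" for L :: "('v, 'c) logic" where
  Atom: "Atom p \<in> formulas L"
| Conn: "length \<phi>s = arity L c \<Longrightarrow> (\<And>\<phi>. \<phi> \<in> set \<phi>s \<Longrightarrow> \<phi> \<in> formulas L) \<Longrightarrow> Conn c \<phi>s \<in> formulas L"

primrec val :: "('v, 'c) logic \<Rightarrow> ('p \<Rightarrow> 'v) \<Rightarrow> ('p, 'c) fm \<Rightarrow> 'v" where
  "val L I (Atom p) = I p"
| "val L I (Conn c \<phi>s) = tfun L c (map (val L I) \<phi>s)"

definition model :: "('v, 'c) logic \<Rightarrow> ('p \<Rightarrow> 'v) \<Rightarrow> ('p, 'c) fm \<Rightarrow> bool" where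
  "model L I \<phi> \<longleftrightarrow> val L I \<phi> \<in> designated L"

definition model_of :: "('v, 'c) logic \<Rightarrow> ('p \<Rightarrow> 'v) \<Rightarrow> ('p, 'c) fm set \<Rightarrow> bool" where
  "model_of L I \<Gamma> \<longleftrightarrow> (\<forall>\<phi>\<in>\<Gamma>. model L I \<phi>)"

text \<open>\<open>cI\<close> and \<open>cN\<close> are the two unary connectives testing membership and
  non-membership in the set \<open>T\<close> of truth values.\<close>

definition membership_connectives :: "('v, 'c) logic \<Rightarrow> 'v set \<Rightarrow> 'c \<Rightarrow> 'c \<Rightarrow> bool" where
  "membership_connectives L T cI cN \<longleftrightarrow>
     arity L cI = 1 \<and> (\<forall>x. tfun L cI [x] = (if x \<in> T then tt L else ff L)) \<and>
     arity L cN = 1 \<and> (\<forall>x. tfun L cN [x] = (if x \<notin> T then tt L else ff L))"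


section \<open>Sequents, anti-sequents, and their calculi\<close>

text \<open>
  The components of a sequent or anti-sequent are indexed by the truth values themselves
  instead of by \<open>1, \<dots>, n\<close>.
\<close>

type_synonym ('p, 'c, 'v) sequent = "'v \<Rightarrow> ('p, 'c) fm set"

definition is_sequent :: "('v, 'c) logic \<Rightarrow> ('p, 'c, 'v) sequent \<Rightarrow> bool" where
  "is_sequent L G \<longleftrightarrow> (\<forall>u. finite (G u) \<and> G u \<subseteq> formulas L)"

definition add_at :: "('p, 'c, 'v) sequent \<Rightarrow> 'v \<Rightarrow> ('p, 'c) fm \<Rightarrow> ('p, 'c, 'v) sequent" where
  "add_at G u \<phi> = G(u := insert \<phi> (G u))"

text \<open>
  A clause is a set of pairs \<open>(k, w)\<close>, read as the disjunction of the statements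
  ``argument \<open>k\<close> has value \<open>w\<close>''. A partial normal form \<open>P c u\<close> is a set of clauses whose
  conjunction expresses that an application of \<open>c\<close> has value \<open>u\<close>.
  The introduction rules for \<open>c\<close> at place \<open>u\<close> are read off from \<open>P c u\<close>.
  Partial normal forms are not unique, so both calculi are parameterised by a choice of them.
\<close>

type_synonym ('v, 'c) pnf = "'c \<Rightarrow> 'v \<Rightarrow> (nat \<times> 'v) set set"

definition is_pnf :: "('v, 'c) logic \<Rightarrow> ('v, 'c) pnf \<Rightarrow> bool" where
  "is_pnf L P \<longleftrightarrow> (\<forall>c u.
     (\<forall>C \<in> P c u. \<forall>(k, w) \<in> C. k < arity L c) \<and>
     (\<forall>xs. length xs = arity L c \<longrightarrow>
        (tfun L c xs = u \<longleftrightarrow> (\<forall>C \<in> P c u. \<exists>(k, w) \<in> C. xs ! k = w))))"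

text \<open>Partial normal forms always exist: one clause for every row of the truth table that does
  not yield \<open>u\<close>.\<close>

lemma is_pnf_truth_table:
  "is_pnf L (\<lambda>c u. {{(k, w). k < arity L c \<and> w \<noteq> ys ! k} | ys.
     length ys = arity L c \<and> tfun L c ys \<noteq> u})"
proof -
  let ?C = "\<lambda>c ys. {(k, w). k < arity L c \<and> w \<noteq> ys ! k}"
  have A: "tfun L c xs = u" (is "?val")
    if xs: "length xs = arity L c"
      and *: "\<forall>C \<in> {?C c ys | ys. length ys = arity L c \<and> tfun L c ys \<noteq> u}. \<exists>(k, w) \<in> C. xs ! k = w"
    for c u xs
  proof (rule ccontr)
    assume "\<not> ?val"
    with xs * have "\<exists>(k, w) \<in> ?C c xs. xs ! k = w"
      by blast
    then show False
      by auto
  qed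
  have B: "\<exists>(k, w) \<in> ?C c ys. xs ! k = w"
    if *: "length xs = arity L c" "length ys = arity L c" "tfun L c ys \<noteq> tfun L c xs" for c xs ys
  proof -
    obtain k where "k < arity L c" "xs ! k \<noteq> ys ! k"
      using * nth_equalityI[of xs ys] by metis
    then show ?thesis
      by (intro bexI[of _ "(k, xs ! k)"]) auto
  qed
  show ?thesis
    unfolding is_pnf_def
  proof (intro allI conjI impI iffI)
    show "\<forall>C \<in> {?C c ys | ys. length ys = arity L c \<and> tfun L c ys \<noteq> u}. \<forall>(k, w) \<in> C. k < arity L c"
      for c u
      by auto
  next
    fix c u xs
    assume xs: "length xs = arity L c" "tfun L c xs = u"
    show "\<forall>C \<in> {?C c ys | ys. length ys = arity L c \<and> tfun L c ys \<noteq> u}. \<exists>(k, w) \<in> C. xs ! k = w"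
    proof
      fix C
      assume "C \<in> {?C c ys | ys. length ys = arity L c \<and> tfun L c ys \<noteq> u}"
      then obtain ys where "C = ?C c ys" "length ys = arity L c" "tfun L c ys \<noteq> tfun L c xs"
        using xs by blast
      then show "\<exists>(k, w) \<in> C. xs ! k = w"
        using B xs(1) by simp
    qed
  qed (rule A)
qed

definition add_clause ::
    "('p, 'c, 'v) sequent \<Rightarrow> (nat \<times> 'v) set \<Rightarrow> ('p, 'c) fm list \<Rightarrow> ('p, 'c, 'v) sequent" where
  "add_clause G C \<phi>s = (\<lambda>w. G w \<union> {\<phi>s ! k | k. (k, w) \<in> C})"

text \<open>Zach's sequent calculus. Components are sets, so exchange and contraction are implicit.\<close>

inductive S_provable :: "('v, 'c) logic \<Rightarrow> ('v, 'c) pnf \<Rightarrow> ('p, 'c, 'v) sequent \<Rightarrow> bool"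
  for L :: "('v, 'c) logic" and P :: "('v, 'c) pnf" where
  axiom: "\<phi> \<in> formulas L \<Longrightarrow> S_provable L P (\<lambda>_. {\<phi>})"
| weakening: "S_provable L P G \<Longrightarrow> \<phi> \<in> formulas L \<Longrightarrow> S_provable L P (add_at G u \<phi>)"
| cut: "u \<noteq> w \<Longrightarrow> S_provable L P (add_at G u \<phi>) \<Longrightarrow> S_provable L P (add_at H w \<phi>) \<Longrightarrow>
    S_provable L P (\<lambda>x. G x \<union> H x)"
| intro: "is_sequent L G \<Longrightarrow> Conn c \<phi>s \<in> formulas L \<Longrightarrow>
    (\<And>C. C \<in> P c u \<Longrightarrow> S_provable L P (add_clause G C \<phi>s)) \<Longrightarrow>
    S_provable L P (add_at G u (Conn c \<phi>s))"

text \<open>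
  The anti-sequent calculus of Bogojeski and Tompits: the axioms are the anti-sequents of
  propositional constants without a constant common to all components, and each premise of an
  introduction rule of the sequent calculus yields a rule with that single premise.
\<close>

inductive R_provable :: "('v, 'c) logic \<Rightarrow> ('v, 'c) pnf \<Rightarrow> ('p, 'c, 'v) sequent \<Rightarrow> bool"
  for L :: "('v, 'c) logic" and P :: "('v, 'c) pnf" where
  axiom: "(\<And>u. finite (G u) \<and> G u \<subseteq> range Atom) \<Longrightarrow> (\<Inter>u. G u) = {} \<Longrightarrow> R_provable L P G"
| intro: "Conn c \<phi>s \<in> formulas L \<Longrightarrow> C \<in> P c u \<Longrightarrow> R_provable L P (add_clause G C \<phi>s) \<Longrightarrow>
    R_provable L P (add_at G u (Conn c \<phi>s))"

text \<open>The sequent \<open>\<Gamma> \<turnstile> \<Delta>\<close> and likewise the anti-sequent \<open>\<Gamma> \<stileturn> \<Delta>\<close>.\<close>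

definition two_sided ::
    "('v, 'c) logic \<Rightarrow> ('p, 'c) fm set \<Rightarrow> ('p, 'c) fm set \<Rightarrow> ('p, 'c, 'v) sequent" where
  "two_sided L \<Gamma> \<Delta> = (\<lambda>u. if u \<in> designated L then \<Delta> else \<Gamma>)"


section \<open>Minimal entailment\<close>

definition int_le ::
    "('v, 'c) logic \<Rightarrow> 'v set \<Rightarrow> 'p set \<Rightarrow> ('p \<Rightarrow> 'v) \<Rightarrow> ('p \<Rightarrow> 'v) \<Rightarrow> bool" where
  "int_le L T \<Theta> I J \<longleftrightarrow>
     {p \<in> \<Theta>. val L I (Atom p) \<in> T} \<subseteq> {p \<in> \<Theta>. val L J (Atom p) \<in> T}"

definition int_less ::
    "('v, 'c) logic \<Rightarrow> 'v set \<Rightarrow> 'p set \<Rightarrow> ('p \<Rightarrow> 'v) \<Rightarrow> ('p \<Rightarrow> 'v) \<Rightarrow> bool" where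
  "int_less L T \<Theta> I J \<longleftrightarrow> int_le L T \<Theta> I J \<and> \<not> int_le L T \<Theta> J I"

definition minimal_model ::
    "('v, 'c) logic \<Rightarrow> 'v set \<Rightarrow> 'p set \<Rightarrow> ('p, 'c) fm set \<Rightarrow> ('p \<Rightarrow> 'v) \<Rightarrow> bool" where
  "minimal_model L T \<Theta> \<Gamma> I \<longleftrightarrow>
     model_of L I \<Gamma> \<and> \<not> (\<exists>J. model_of L J \<Gamma> \<and> int_less L T \<Theta> J I)"

text \<open>
  In \<open>ME_true\<close> and \<open>ME_provable\<close> the last four arguments \<open>\<Sigma> \<Gamma> \<Delta> \<Theta>\<close> form the
  sequent \<open>\<Sigma>; \<Gamma> \<Rightarrow> \<Delta>; \<Theta>\<close>.
\<close>

definition ME_true ::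
    "('v, 'c) logic \<Rightarrow> 'v set \<Rightarrow> 'p set \<Rightarrow> ('p, 'c) fm set \<Rightarrow> ('p, 'c) fm set \<Rightarrow> 'p set \<Rightarrow> bool" where
  "ME_true L T \<Sigma> \<Gamma> \<Delta> \<Theta> \<longleftrightarrow>
     (\<forall>I. minimal_model L T (\<Theta> \<union> \<Sigma>) \<Gamma> I \<and> (\<forall>p\<in>\<Sigma>. val L I (Atom p) \<in> T) \<longrightarrow>
        (\<exists>\<phi>\<in>\<Delta>. model L I \<phi>))"

abbreviation conn_atoms :: "'c \<Rightarrow> 'p set \<Rightarrow> ('p, 'c) fm set" where
  "conn_atoms c \<Theta> \<equiv> (\<lambda>p. Conn c [Atom p]) ` \<Theta>"

text \<open>
  The set \<open>T\<close> of truth values enters the calculus only through the connectives \<open>cI\<close> and \<open>cN\<close>;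
  \<open>P\<close> and \<open>Q\<close> are the partial normal forms underlying the sequent and the anti-sequent calculus.
\<close>

inductive ME_provable ::
    "('v, 'c) logic \<Rightarrow> 'c \<Rightarrow> 'c \<Rightarrow> ('v, 'c) pnf \<Rightarrow> ('v, 'c) pnf \<Rightarrow>
     'p set \<Rightarrow> ('p, 'c) fm set \<Rightarrow> ('p, 'c) fm set \<Rightarrow> 'p set \<Rightarrow> bool"
  for L :: "('v, 'c) logic" and cI cN :: 'c and P Q :: "('v, 'c) pnf" where
  m1: "R_provable L Q (two_sided L (\<Gamma> \<union> conn_atoms cN \<Theta>) {Conn cI [Atom q]}) \<Longrightarrow>
    \<Delta> \<subseteq> formulas L \<Longrightarrow>
    ME_provable L cI cN P Q ({q} \<union> \<Sigma>) \<Gamma> \<Delta> \<Theta>"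
| m2: "S_provable L P (two_sided L (conn_atoms cI \<Sigma> \<union> \<Gamma>) \<Delta>) \<Longrightarrow>
    ME_provable L cI cN P Q \<Sigma> \<Gamma> \<Delta> \<Theta>"
| m3: "ME_provable L cI cN P Q ({q} \<union> \<Sigma>) \<Gamma> \<Delta> \<Theta> \<Longrightarrow>
    ME_provable L cI cN P Q \<Sigma> (\<Gamma> \<union> {Conn cN [Atom q]}) \<Delta> \<Theta> \<Longrightarrow>
    ME_provable L cI cN P Q \<Sigma> \<Gamma> \<Delta> (\<Theta> \<union> {q})"

end

(* Both calculi are complete by the same induction on sequents: a compound formula is replaced by
   the clauses of its partial normal form, and an interpretation makes the sequent true iff it makes
   every premise true.
   For minimal entailment, induct on \<Theta>. If \<Theta> is empty and rule m2 does not apply, some model of \<Gamma>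
   with all constants of \<Sigma> in T falsifies \<Delta>; as it is not minimal, a smaller model of \<Gamma> leaves T
   on some q in \<Sigma>, and m1 applies. Otherwise both premises of m3 are true: a minimal model
   of \<Gamma> with cN q remains minimal for \<Gamma> when q is added to the minimised constants, because every
   smaller model also keeps q outside T. *)
theory Submission
  imports Defs "HOL-Library.Cardinality"
begin

section \<open>Truth of sequents and the clause semantics of introduction rules\<close>

text \<open>An anti-sequent is refuted by \<open>I\<close> exactly when this fails, so one predicate
  serves both calculi.\<close>

definition sequent_true :: "('v, 'c) logic \<Rightarrow> ('p \<Rightarrow> 'v) \<Rightarrow> ('p, 'c, 'v) sequent \<Rightarrow> bool" where
  "sequent_true L I G \<longleftrightarrow> (\<exists>u. \<exists>\<phi>\<in>G u. val L I \<phi> = u)"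

lemma sequent_true_add_at:
  "sequent_true L I (add_at G u \<phi>) \<longleftrightarrow> sequent_true L I G \<or> val L I \<phi> = u"
  unfolding sequent_true_def add_at_def by (auto split: if_splits)

lemma sequent_true_add_clause:
  "sequent_true L I (add_clause G C \<phi>s) \<longleftrightarrow>
    sequent_true L I G \<or> (\<exists>(k, w)\<in>C. val L I (\<phi>s ! k) = w)"
  unfolding sequent_true_def add_clause_def by auto

lemma Conn_in_formulas_iff:
  "Conn c \<phi>s \<in> formulas L \<longleftrightarrow> length \<phi>s = arity L c \<and> set \<phi>s \<subseteq> formulas L"
  by (auto intro: formulas.Conn elim: formulas.cases)

lemma val_Conn_iff_pnf:
  assumes "is_pnf L P" "Conn c \<phi>s \<in> formulas L"
  shows "val L I (Conn c \<phi>s) = u \<longleftrightarrow> (\<forall>C\<in>P c u. \<exists>(k, w)\<in>C. val L I (\<phi>s ! k) = w)"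
proof -
  have len: "length \<phi>s = arity L c"
    using assms(2) by (simp add: Conn_in_formulas_iff)
  have bound: "\<forall>C\<in>P c u. \<forall>(k, w)\<in>C. k < arity L c"
    using assms(1) unfolding is_pnf_def by blast
  have "val L I (Conn c \<phi>s) = u \<longleftrightarrow> (\<forall>C\<in>P c u. \<exists>(k, w)\<in>C. map (val L I) \<phi>s ! k = w)"
    using assms(1) len unfolding is_pnf_def by simp
  \<comment> \<open>The clauses mention only indices below the arity; for these, \<open>nth\<close>
    commutes with \<open>map\<close>.\<close>
  also have "\<dots> \<longleftrightarrow> (\<forall>C\<in>P c u. \<exists>(k, w)\<in>C. val L I (\<phi>s ! k) = w)"
    using bound len by (intro ball_cong bex_cong refl) fastforce+
  finally show ?thesis .
qed

text \<open>Disjunction with the context distributes over the conjunction of clauses. Left to right,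
  validity passes to all premises; right to left, refutation of the conclusion passes to some
  premise, with the same \<open>I\<close>.\<close>

lemma sequent_true_intro_iff:
  assumes "is_pnf L P" "Conn c \<phi>s \<in> formulas L"
  shows "sequent_true L I (add_at G u (Conn c \<phi>s)) \<longleftrightarrow>
    (\<forall>C\<in>P c u. sequent_true L I (add_clause G C \<phi>s))"
  unfolding sequent_true_add_at sequent_true_add_clause val_Conn_iff_pnf[OF assms] by blast

section \<open>A weight on sequents and the induction it supports\<close>

text \<open>A premise of an introduction rule may contain an argument in every component; with \<open>n\<close> the
  number of components, \<open>fm_weight n\<close> decreases nevertheless.\<close>

primrec fm_weight :: "nat \<Rightarrow> ('p, 'c) fm \<Rightarrow> nat" where
  "fm_weight n (Atom p) = 0"
| "fm_weight n (Conn c \<phi>s) = Suc (n * sum_list (map (fm_weight n) \<phi>s))"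

definition sequent_weight :: "('p, 'c, 'v::finite) sequent \<Rightarrow> nat" where
  "sequent_weight G = (\<Sum>u\<in>UNIV. sum (fm_weight CARD('v)) (G u))"

lemma sum_set_le_sum_list:
  fixes f :: "'a \<Rightarrow> nat"
  shows "sum f (set xs) \<le> sum_list (map f xs)"
  by (induction xs) (auto simp: sum.insert_if)

lemma is_sequent_add_clause:
  assumes "is_sequent L G" "Conn c \<phi>s \<in> formulas L" "\<forall>(k, w)\<in>C. k < arity L c"
  shows "is_sequent L (add_clause G C \<phi>s)"
proof -
  have sub: "{\<phi>s ! k | k. (k, w) \<in> C} \<subseteq> set \<phi>s" for w
    using assms(2,3) by (auto simp: Conn_in_formulas_iff)
  then have "finite {\<phi>s ! k | k. (k, w) \<in> C}" for w
    by (rule finite_subset) simp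
  then show ?thesis
    using assms(1,2) sub unfolding is_sequent_def add_clause_def Conn_in_formulas_iff
    by blast
qed

text \<open>Each of the \<open>CARD('v)\<close> components gains at most the total weight of the
  arguments; the \<open>Suc\<close> in \<open>fm_weight\<close> makes the inequality strict.\<close>

lemma sequent_weight_add_clause:
  fixes G :: "('p, 'c, 'v::finite) sequent"
  assumes "is_sequent L G" "Conn c \<phi>s \<in> formulas L" "\<forall>(k, w)\<in>C. k < arity L c"
  shows "sequent_weight (add_clause G C \<phi>s) < sequent_weight G + fm_weight CARD('v) (Conn c \<phi>s)"
proof -
  let ?f = "fm_weight CARD('v) :: ('p, 'c) fm \<Rightarrow> nat"
  have "sum ?f (add_clause G C \<phi>s w) \<le> sum ?f (G w) + sum_list (map ?f \<phi>s)" for w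
  proof -
    let ?X = "{\<phi>s ! k | k. (k, w) \<in> C}"
    have sub: "?X \<subseteq> set \<phi>s"
      using assms(2,3) by (auto simp: Conn_in_formulas_iff)
    have fin: "finite ?X"
      using sub by (rule finite_subset) simp
    have "sum ?f (add_clause G C \<phi>s w) \<le> sum ?f (G w) + sum ?f ?X"
      using assms(1) sum.union_inter[OF _ fin, of "G w" ?f]
      unfolding add_clause_def is_sequent_def by simp
    also have "sum ?f ?X \<le> sum ?f (set \<phi>s)"
      using sub by (intro sum_mono2) auto
    also have "\<dots> \<le> sum_list (map ?f \<phi>s)"
      by (rule sum_set_le_sum_list)
    finally show ?thesis by simp
  qed
  then have "sequent_weight (add_clause G C \<phi>s)
      \<le> (\<Sum>w\<in>UNIV. sum ?f (G w) + sum_list (map ?f \<phi>s))"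
    unfolding sequent_weight_def by (intro sum_mono)
  then show ?thesis
    by (simp add: sequent_weight_def sum.distrib)
qed

lemma sequent_weight_add_at:
  fixes G :: "('p, 'c, 'v::finite) sequent"
  assumes "finite (G u)" "\<phi> \<notin> G u"
  shows "sequent_weight (add_at G u \<phi>) = sequent_weight G + fm_weight CARD('v) \<phi>"
proof -
  let ?f = "fm_weight CARD('v) :: ('p, 'c) fm \<Rightarrow> nat"
  have "sum ?f (add_at G u \<phi> w) = sum ?f (G w) + (if u = w then ?f \<phi> else 0)" for w
    using assms by (auto simp: add_at_def)
  then show ?thesis
    by (simp add: sequent_weight_def sum.distrib)
qed

lemma sequent_induct [consumes 2, case_names atomic intro]:
  fixes G :: "('p, 'c, 'v::finite) sequent"
  assumes "is_pnf L P" "is_sequent L G"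
    and atomic: "\<And>G. is_sequent L G \<Longrightarrow> (\<And>u. G u \<subseteq> range Atom) \<Longrightarrow> R G"
    and intro: "\<And>G u c \<phi>s. is_sequent L G \<Longrightarrow> Conn c \<phi>s \<in> formulas L \<Longrightarrow>
      (\<And>C. C \<in> P c u \<Longrightarrow> R (add_clause G C \<phi>s)) \<Longrightarrow> R (add_at G u (Conn c \<phi>s))"
  shows "R G"
  using assms(2)
proof (induction "sequent_weight G" arbitrary: G rule: less_induct)
  case less
  show ?case
  proof (cases "\<forall>u. G u \<subseteq> range Atom")
    case True
    then show ?thesis
      using atomic less.prems by blast
  next
    case False
    then obtain u \<psi> where "\<psi> \<in> G u" "\<psi> \<notin> range Atom"
      by blast
    then obtain c \<phi>s where in_G: "Conn c \<phi>s \<in> G u"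
      by (cases \<psi>) auto
    \<comment> \<open>Components are sets, so the principal formula has to be removed first: only
      then do the premises lose it and the weights add up exactly.\<close>
    define H where "H = G(u := G u - {Conn c \<phi>s})"
    have G: "G = add_at H u (Conn c \<phi>s)"
      using in_G by (auto simp: H_def add_at_def insert_absorb)
    have H: "is_sequent L H"
      using less.prems by (auto simp: H_def is_sequent_def)
    have fm: "Conn c \<phi>s \<in> formulas L"
      using in_G less.prems by (auto simp: is_sequent_def)
    have weight: "sequent_weight G = sequent_weight H + fm_weight CARD('v) (Conn c \<phi>s)"
      unfolding G
    by (rule sequent_weight_add_at) (use H in \<open>simp_all add: is_sequent_def\<close>, simp add: H_def)
    have "R (add_clause H C \<phi>s)" if "C \<in> P c u" for C
    proof -
      have "\<forall>(k, w)\<in>C. k < arity L c"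
        using assms(1) that unfolding is_pnf_def by blast
      then show ?thesis
        using less.hyps sequent_weight_add_clause[OF H fm] is_sequent_add_clause[OF H fm] weight
        by metis
    qed
    then show ?thesis
      unfolding G using intro H fm by blast
  qed
qed

section \<open>Completeness of the sequent and anti-sequent calculi\<close>

lemma S_provable_extend_at:
  assumes "S_provable L P G" "finite X" "X \<subseteq> formulas L"
  shows "S_provable L P (G(u := G u \<union> X))"
  using assms(2,3)
proof (induction X rule: finite_induct)
  case empty
  then show ?case using assms(1) by simp
next
  case (insert \<phi> X)
  then have "S_provable L P (add_at (G(u := G u \<union> X)) u \<phi>)"
    by (intro S_provable.weakening insert.IH) auto
  then show ?case
    by (simp add: add_at_def fun_upd_def cong: if_cong)
qed

lemma S_provable_mono:
  fixes G H :: "('p, 'c, 'v::finite) sequent"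
  assumes "S_provable L P G" "is_sequent L H" "\<And>u. G u \<subseteq> H u"
  shows "S_provable L P H"
proof -
  \<comment> \<open>\<open>A\<close> collects the components already enlarged to those of
    \<open>H\<close>; finiteness of \<open>'v\<close> lets it reach \<open>UNIV\<close>.\<close>
  have "S_provable L P (\<lambda>u. if u \<in> A then H u else G u)" if "finite A" for A
    using that
  proof (induction A rule: finite_induct)
    case empty
    then show ?case using assms(1) by simp
  next
    case (insert a A)
    have "S_provable L P ((\<lambda>u. if u \<in> A then H u else G u)
        (a := (if a \<in> A then H a else G a) \<union> H a))"
      using S_provable_extend_at[OF insert.IH] assms(2) by (simp add: is_sequent_def)
    also have "(\<lambda>u. if u \<in> A then H u else G u)(a := (if a \<in> A then H a else G a) \<union> H a)
        = (\<lambda>u. if u \<in> insert a A then H u else G u)"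
      using assms(3) by (auto simp: fun_eq_iff)
    finally show ?case .
  qed
  from this[of UNIV] show ?thesis by simp
qed

theorem S_complete:
  fixes G :: "('p, 'c, 'v::finite) sequent"
  assumes "is_pnf L P" "is_sequent L G" "\<And>I. sequent_true L I G"
  shows "S_provable L P G"
  using assms
proof (induction G rule: sequent_induct)
  case (atomic G)
  have "\<exists>p. \<forall>u. Atom p \<in> G u"
  proof (rule ccontr)
    assume "\<not> ?thesis"
    \<comment> \<open>Each constant gets as its value a component from which it is absent, so this
      \<open>I\<close> falsifies the atomic sequent.\<close>
    then obtain I where "\<And>p. Atom p \<notin> G (I p)"
      by metis
    then have "\<not> sequent_true L I G"
      using atomic(2) by (fastforce simp: sequent_true_def)
    then show False
      using atomic(3) by blast
  qed
  then obtain p where "\<And>u. Atom p \<in> G u"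
    by blast
  then show ?case
    using S_provable_mono[OF S_provable.axiom[OF formulas.Atom] atomic(1)] by blast
next
  case (intro G u c \<phi>s)
  have "sequent_true L I (add_clause G C \<phi>s)" if "C \<in> P c u" for C I
    using intro.prems that sequent_true_intro_iff[OF assms(1) intro.hyps(2)] by blast
  then show ?case
    using intro by (intro S_provable.intro) auto
qed

text \<open>A single refuting \<open>I\<close> guides the whole derivation: at each compound formula
  some clause fails under \<open>I\<close>, which selects the one premise needed.\<close>

theorem R_complete:
  fixes G :: "('p, 'c, 'v::finite) sequent"
  assumes "is_pnf L P" "is_sequent L G" "\<not> sequent_true L I G"
  shows "R_provable L P G"
  using assms
proof (induction G rule: sequent_induct)
  case (atomic G)
  have "(\<Inter>u. G u) = {}"
  proof (rule ccontr)
    assume "\<not> ?thesis"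
    \<comment> \<open>A formula common to all components also lies in the one indexed by its own
      value under \<open>I\<close>.\<close>
    then obtain \<phi> where "\<And>u. \<phi> \<in> G u"
      by blast
    then show False
      using atomic(3) by (auto simp: sequent_true_def)
  qed
  then show ?case
    using atomic(1,2) by (intro R_provable.axiom) (auto simp: is_sequent_def)
next
  case (intro G u c \<phi>s)
  then obtain C where "C \<in> P c u" "\<not> sequent_true L I (add_clause G C \<phi>s)"
    using sequent_true_intro_iff[OF assms(1) intro.hyps(2)] by blast
  then show ?case
    using intro by (intro R_provable.intro) auto
qed

section \<open>Two-sided sequents and the membership connectives\<close>

text \<open>A formula of \<open>\<Gamma>\<close> stands at every non-designated place, so it makes
  the sequent true iff its value is non-designated; dually for \<open>\<Delta>\<close>.\<close>

lemma sequent_true_two_sided: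
  "sequent_true L I (two_sided L \<Gamma> \<Delta>) \<longleftrightarrow>
    (model_of L I \<Gamma> \<longrightarrow> (\<exists>\<phi>\<in>\<Delta>. model L I \<phi>))"
  unfolding sequent_true_def two_sided_def model_of_def model_def
  by (auto split: if_splits) metis+

lemma is_sequent_two_sided:
  assumes "finite \<Gamma>" "\<Gamma> \<subseteq> formulas L" "finite \<Delta>" "\<Delta> \<subseteq> formulas L"
  shows "is_sequent L (two_sided L \<Gamma> \<Delta>)"
  using assms by (simp add: is_sequent_def two_sided_def)

lemma membership_connectives_formulas:
  assumes "membership_connectives L T cI cN"
  shows "Conn cI [Atom p] \<in> formulas L" "Conn cN [Atom p] \<in> formulas L"
  using assms by (auto simp: membership_connectives_def Conn_in_formulas_iff intro: formulas.Atom)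

lemma model_membership_connectives:
  assumes "finite_valued_logic L" "membership_connectives L T cI cN"
  shows "model L I (Conn cI [Atom p]) \<longleftrightarrow> I p \<in> T"
    and "model L I (Conn cN [Atom p]) \<longleftrightarrow> I p \<notin> T"
  using assms by (auto simp: membership_connectives_def finite_valued_logic_def model_def)

section \<open>Completeness for minimal entailment\<close>

lemma ME_complete_empty:
  fixes L :: "('v::finite, 'c::finite) logic"
  assumes L: "finite_valued_logic L" "membership_connectives L T cI cN"
    and pnf: "is_pnf L P" "is_pnf L Q"
    and fin: "finite \<Sigma>" "finite \<Gamma>" "\<Gamma> \<subseteq> formulas L" "finite \<Delta>" "\<Delta> \<subseteq> formulas L"
    and true: "ME_true L T \<Sigma> \<Gamma> \<Delta> {}"
  shows "ME_provable L cI cN P Q \<Sigma> \<Gamma> \<Delta> {}"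
proof (cases "\<forall>I. sequent_true L I (two_sided L (conn_atoms cI \<Sigma> \<union> \<Gamma>) \<Delta>)")
  case True
  have "is_sequent L (two_sided L (conn_atoms cI \<Sigma> \<union> \<Gamma>) \<Delta>)"
    using fin membership_connectives_formulas[OF L(2)] by (intro is_sequent_two_sided) auto
  then show ?thesis
    using S_complete[OF pnf(1)] True by (blast intro: ME_provable.m2)
next
  case False
  then obtain I where I: "model_of L I \<Gamma>" "\<forall>p\<in>\<Sigma>. I p \<in> T" "\<not> (\<exists>\<phi>\<in>\<Delta>. model L I \<phi>)"
    by (auto simp: sequent_true_two_sided model_of_def ball_Un model_membership_connectives[OF L])
  then have "\<not> minimal_model L T \<Sigma> \<Gamma> I"
    using true by (auto simp: ME_true_def)
  \<comment> \<open>All of \<open>\<Sigma>\<close> is in \<open>T\<close> under \<open>I\<close>, so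
    a strictly smaller \<open>J\<close> must take some \<open>q\<close> of \<open>\<Sigma>\<close>
    out of \<open>T\<close>.\<close>
  then obtain J q where J: "model_of L J \<Gamma>" "q \<in> \<Sigma>" "J q \<notin> T"
    using I(1) unfolding minimal_model_def int_less_def int_le_def by auto
  then have "\<not> sequent_true L J (two_sided L (\<Gamma> \<union> conn_atoms cN {}) {Conn cI [Atom q]})"
    by (simp add: sequent_true_two_sided model_membership_connectives[OF L])
  moreover have "is_sequent L (two_sided L (\<Gamma> \<union> conn_atoms cN {}) {Conn cI [Atom q]})"
    using fin membership_connectives_formulas[OF L(2)] by (intro is_sequent_two_sided) auto
  ultimately have "R_provable L Q (two_sided L (\<Gamma> \<union> conn_atoms cN {}) {Conn cI [Atom q]})"
    by (intro R_complete[OF pnf(2)])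
  then have "ME_provable L cI cN P Q ({q} \<union> \<Sigma>) \<Gamma> \<Delta> {}"
    using fin(5) by (rule ME_provable.m1)
  \<comment> \<open>As \<open>q\<close> already belongs to \<open>\<Sigma>\<close>, the conclusion
    of \<open>m1\<close> is the desired sequent.\<close>
  then show ?thesis
    using J(2) by (simp add: insert_absorb)
qed

text \<open>Moving \<open>q\<close> to the left keeps the set of minimised constants and only
  restricts attention to models with \<open>q\<close> in \<open>T\<close>.\<close>

lemma ME_true_m3_left:
  assumes "ME_true L T \<Sigma> \<Gamma> \<Delta> (\<Theta> \<union> {q})"
  shows "ME_true L T ({q} \<union> \<Sigma>) \<Gamma> \<Delta> \<Theta>"
  using assms by (simp add: ME_true_def)

lemma ME_true_m3_right:
  assumes L: "finite_valued_logic L" "membership_connectives L T cI cN"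
    and true: "ME_true L T \<Sigma> \<Gamma> \<Delta> (\<Theta> \<union> {q})"
  shows "ME_true L T \<Sigma> (\<Gamma> \<union> {Conn cN [Atom q]}) \<Delta> \<Theta>"
  unfolding ME_true_def
proof (intro allI impI, elim conjE)
  fix I
  assume min: "minimal_model L T (\<Theta> \<union> \<Sigma>) (\<Gamma> \<union> {Conn cN [Atom q]}) I"
    and \<Sigma>: "\<forall>p\<in>\<Sigma>. val L I (Atom p) \<in> T"
  have I: "model_of L I \<Gamma>" "I q \<notin> T"
    using min by (auto simp: minimal_model_def model_of_def model_membership_connectives[OF L])
  have "minimal_model L T ((\<Theta> \<union> {q}) \<union> \<Sigma>) \<Gamma> I"
    unfolding minimal_model_def
  proof (intro conjI notI)
    assume "\<exists>J. model_of L J \<Gamma> \<and> int_less L T ((\<Theta> \<union> {q}) \<union> \<Sigma>) J I"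
    then obtain J where J: "model_of L J \<Gamma>" "int_less L T ((\<Theta> \<union> {q}) \<union> \<Sigma>) J I"
      by blast
    \<comment> \<open>Here \<open>q\<close> is among the minimised constants, and it is outside
      \<open>T\<close> under \<open>I\<close>.\<close>
    have "J q \<notin> T"
      using J(2) I(2) by (auto simp: int_less_def int_le_def)
    \<comment> \<open>With \<open>q\<close> outside \<open>T\<close> under both \<open>J\<close> and
      \<open>I\<close>, the strict inclusion must be witnessed in
      \<open>\<Theta> \<union> \<Sigma>\<close>.\<close>
    then have "model_of L J (\<Gamma> \<union> {Conn cN [Atom q]})" "int_less L T (\<Theta> \<union> \<Sigma>) J I"
      using J I(2)
      by (auto simp: model_of_def model_membership_connectives[OF L] int_less_def int_le_def)
    then show False
      using min by (auto simp: minimal_model_def)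
  qed (rule I(1))
  then show "\<exists>\<phi>\<in>\<Delta>. model L I \<phi>"
    using true \<Sigma> by (simp add: ME_true_def)
qed

theorem mainTheorem3:
  fixes L :: "('v::finite, 'c::finite) logic"
    and T :: "'v set"
    and cI cN :: 'c
    and P Q :: "('v, 'c) pnf"
    and \<Sigma> \<Theta> :: "'p::{countable,infinite} set"
    and \<Gamma> \<Delta> :: "('p, 'c) fm set"
  assumes "finite_valued_logic L"
    and "membership_connectives L T cI cN"
    and "is_pnf L P" and "is_pnf L Q"
    and "finite \<Sigma>" and "finite \<Theta>"
    and "finite \<Gamma>" and "\<Gamma> \<subseteq> formulas L"
    and "finite \<Delta>" and "\<Delta> \<subseteq> formulas L"
    and "ME_true L T \<Sigma> \<Gamma> \<Delta> \<Theta>"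
  shows "ME_provable L cI cN P Q \<Sigma> \<Gamma> \<Delta> \<Theta>"
  using assms(6,5,7,8,11)
\<comment> \<open>\<open>\<Sigma>\<close> and \<open>\<Gamma>\<close> must vary: the premises of
  \<open>m3\<close> put \<open>q\<close> into the former or \<open>cN\<close> applied to
  \<open>q\<close> into the latter.\<close>
proof (induction \<Theta> arbitrary: \<Sigma> \<Gamma> rule: finite_induct)
  case empty
  then show ?case
    using ME_complete_empty[OF assms(1-4)] assms(9,10) by blast
next
  case (insert q \<Theta>)
  have true: "ME_true L T \<Sigma> \<Gamma> \<Delta> (\<Theta> \<union> {q})"
    using insert.prems by simp
  have "ME_provable L cI cN P Q ({q} \<union> \<Sigma>) \<Gamma> \<Delta> \<Theta>"
    using insert.prems ME_true_m3_left[OF true] by (intro insert.IH) auto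
  moreover have "ME_provable L cI cN P Q \<Sigma> (\<Gamma> \<union> {Conn cN [Atom q]}) \<Delta> \<Theta>"
    using insert.prems membership_connectives_formulas(2)[OF assms(2)]
      ME_true_m3_right[OF assms(1,2) true]
    by (intro insert.IH) auto
  ultimately show ?case
    using ME_provable.m3 by fastforce
qed

end
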